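(* Let $\Omega\subseteq\{1,\dots,n\}\times\{1,\dots,n\}$ with $m=|\Omega|>2nr-r^2$. If one chooses randomly the entries of an $n\times n$ matrix in the positions $\Omega$, the probability of completing the matrix to a rank $r$ matrix with the given known entries is $0$. That is, the set of vectors $\mathbf{x}\in\mathbb{C}^m$ (indexed by $\Omega$) for which there exists a matrix $X\in\mathbb{C}^{n\times n}$ of rank $r$ with $X|_\Omega=\mathbf{x}$ has Lebesgue measure zero in $\mathbb{C}^m$.
   Context: $X|_\Omega\in\mathbb{C}^m$ denotes the vector of the entries of $X$ at the positions in $\Omega$ (in a fixed order). Here $1\le r\le n$. *)

theory Defs
  imports "HOL-Analysis.Analysis"
begin

text \<open>The entries of \<open>X\<close> at a finite list of positions; the enumeration \<open>\<omega>\<close> of the position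
  set fixes the order, and \<open>'m\<close> is an index type with one element per position.\<close>

definition entries_at :: "('m \<Rightarrow> 'n \<times> 'n) \<Rightarrow> complex ^ 'n ^ 'n \<Rightarrow> complex ^ 'm"
  where "entries_at \<omega> X = (\<chi> k. X $ fst (\<omega> k) $ snd (\<omega> k))"

end

theory Submission
  imports Defs
begin

text \<open>If the rows of \<open>X\<close> indexed by \<open>I\<close> form a basis of the row space, then \<open>X\<close> is determined by
  these \<open>r\<close> rows and by the coefficients expressing the other \<open>n - r\<close> rows through them. So the
  matrices of rank \<open>r\<close> are covered by finitely many polynomial images of a space of dimension
  \<open>n r + (n - r) r = 2 n r - r\<^sup>2 < m\<close>, which we embed in a coordinate hyperplane of the
  \<open>m\<close>-dimensional space; a differentiable map sends this null set to a null set.\<close>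

text \<open>A position \<open>(i, j)\<close> with \<open>i\<close> in \<open>I\<close> holds a
  matrix entry; a position \<open>(i, l)\<close> with \<open>i\<close> outside \<open>I\<close> and
  \<open>l\<close> in \<open>I\<close> holds the coefficient of row \<open>l\<close> in row
  \<open>i\<close>.\<close>

definition param_positions :: "'n set \<Rightarrow> ('n \<times> 'n) set"
  where "param_positions I = I \<times> UNIV \<union> (- I) \<times> I"

text \<open>Here \<open>p\<close> assigns to each parameter position its coordinate in \<open>y\<close>.\<close>

definition fill_rows :: "'n set \<Rightarrow> ('n \<times> 'n \<Rightarrow> 'm) \<Rightarrow> complex ^ 'm \<Rightarrow> complex ^ 'n ^ 'n"
  where "fill_rows I p y = (\<chi> i j. if i \<in> I then y $ p (i, j)
    else (\<Sum>l\<in>I. y $ p (i, l) * y $ p (l, j)))"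

lemma card_param_positions:
  fixes I :: "'n::finite set"
  shows "card (param_positions I) = 2 * CARD('n) * card I - card I ^ 2"
proof -
  \<comment> \<open>With \<open>card I + k\<close> for \<open>CARD('n)\<close> the truncated
    subtraction cancels exactly: both counts become r^2 + 2 k r for r =
    \<open>card I\<close>.\<close>
  obtain k where k: "CARD('n) = card I + k"
    using card_mono[of UNIV I] le_Suc_ex by auto
  have "card (- I) = k"
    using k by (simp add: Compl_eq_Diff_UNIV card_Diff_subset)
  then have "card (param_positions I) = card I * (card I + k) + k * card I"
    unfolding param_positions_def
    by (subst card_Un_disjoint) (auto simp: card_cartesian_product k)
  also have "\<dots> = 2 * CARD('n) * card I - card I ^ 2"
    by (simp add: k power2_eq_square algebra_simps)
  finally show ?thesis .
qed

lemma rank_basis_rows: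
  fixes X :: "complex ^ 'n::finite ^ 'k::finite"
  obtains I c where "card I = rank X" and "\<And>i j. X $ i $ j = (\<Sum>l\<in>I. c i l * X $ l $ j)"
proof -
  obtain B where B: "B \<subseteq> rows X" "vec.independent B" "rows X \<subseteq> vec.span B"
      "card B = vec.dim (rows X)"
    using vec.basis_exists by blast
  have "rows X = (\<lambda>i. row i X) ` UNIV"
    by (auto simp: rows_def)
  \<comment> \<open>Equal rows can sit at several indices; \<open>I\<close> takes one index for each
    vector of \<open>B\<close>, so the cardinalities agree.\<close>
  then obtain I where I: "inj_on (\<lambda>i. row i X) I" "B = (\<lambda>i. row i X) ` I"
    using B(1) by (metis subset_image_inj)
  have "\<exists>d. row i X = (\<Sum>l\<in>I. d l *s row l X)" for i
  proof -
    have "row i X \<in> vec.span B"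
      using B(3) by (auto simp: rows_def)
    then obtain u where "row i X = (\<Sum>v\<in>B. u v *s v)"
      using vec.span_finite[of B] I(2) by auto
    also have "\<dots> = (\<Sum>l\<in>I. u (row l X) *s row l X)"
      using I by (simp add: sum.reindex)
    finally show ?thesis
      by (intro exI[of _ "\<lambda>l. u (row l X)"])
  qed
  then obtain c where c: "\<And>i. row i X = (\<Sum>l\<in>I. c i l *s row l X)"
    by metis
  show thesis
  proof
    show "card I = rank X"
      using I B(4) by (simp add: card_image row_rank_def_gen)
    show "X $ i $ j = (\<Sum>l\<in>I. c i l * X $ l $ j)" for i j
      using arg_cong[OF c[of i], of "\<lambda>v. v $ j"] by (simp add: row_def)
  qed
qed

text \<open>Since \<open>p\<close> is injective, each parameter gets its own coordinate; coordinate
  \<open>k\<close> stores none and may be set to 0.\<close>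

lemma fill_rows_surj:
  fixes X :: "complex ^ 'n::finite ^ 'n" and p :: "'n \<times> 'n \<Rightarrow> 'm::finite"
  assumes p: "inj_on p (param_positions I)" and k: "k \<notin> p ` param_positions I"
    and X: "\<And>i j. X $ i $ j = (\<Sum>l\<in>I. c i l * X $ l $ j)"
  obtains y where "y $ k = 0" and "fill_rows I p y = X"
proof
  define g where "g = (\<lambda>(i, j). if i \<in> I then X $ i $ j else c i j)"
  define y :: "complex ^ 'm" where "y = (\<chi> k. if k \<in> p ` param_positions I
    then g (inv_into (param_positions I) p k) else 0)"
  show "y $ k = 0"
    using k by (simp add: y_def)
  have y: "y $ p q = g q" if "q \<in> param_positions I" for q
    using that p by (simp add: y_def)
  \<comment> \<open>For \<open>l\<close> in \<open>I\<close>, both \<open>(i, l)\<close> and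
    \<open>(l, j)\<close> are parameter positions, where \<open>y\<close> returns
    \<open>c i l\<close> and \<open>X $ l $ j\<close>.\<close>
  have "(\<Sum>l\<in>I. y $ p (i, l) * y $ p (l, j)) = X $ i $ j" if "i \<notin> I" for i j
    using that by (subst X) (auto intro!: sum.cong simp: y param_positions_def g_def)
  then show "fill_rows I p y = X"
    by (auto simp: vec_eq_iff fill_rows_def y param_positions_def g_def)
qed

text \<open>Each entry is a coordinate of \<open>y\<close> or a sum of products of two
  coordinates.\<close>

lemma differentiable_entries_at_fill_rows:
  fixes \<omega> :: "'k::finite \<Rightarrow> 'n::finite \<times> 'n" and p :: "'n \<times> 'n \<Rightarrow> 'm::finite"
  shows "(\<lambda>y. entries_at \<omega> (fill_rows I p y)) differentiable_on S"
proof -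
  have nth: "(\<lambda>y :: complex ^ 'm. y $ q) differentiable (at x within S)" for q x
    by (intro bounded_linear_imp_differentiable bounded_linear_vec_nth)
  have "(\<lambda>y. fill_rows I p y $ i $ j) differentiable (at x within S)" for i j x
    by (cases "i \<in> I") (auto simp: fill_rows_def intro!: nth differentiable_sum differentiable_mult)
  then have "(\<lambda>y. entries_at \<omega> (fill_rows I p y) $ q) differentiable (at x within S)" for q x
    by (simp add: entries_at_def)
  then show ?thesis
    unfolding differentiable_on_def
    by (subst differentiable_componentwise_within) (auto simp: Basis_vec_def inner_axis)
qed

theorem theorem8:
  fixes \<Omega> :: "('n::finite \<times> 'n) set"
    and \<omega> :: "'m::finite \<Rightarrow> 'n \<times> 'n"
    and r :: nat
  assumes "1 \<le> r" and "r \<le> CARD('n)"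
    and "bij_betw \<omega> UNIV \<Omega>"
    and "card \<Omega> > 2 * CARD('n) * r - r ^ 2"
  shows "{x :: complex ^ 'm. \<exists>X :: complex ^ 'n ^ 'n. rank X = r \<and> entries_at \<omega> X = x}
           \<in> null_sets lebesgue"
proof -
  let ?R = "{x. \<exists>X :: complex ^ 'n ^ 'n. rank X = r \<and> entries_at \<omega> X = x}"
  have m: "CARD('m) > 2 * CARD('n) * r - r ^ 2"
    using assms(3,4) bij_betw_same_card by fastforce
  \<comment> \<open>\<open>N\<close> depends on \<open>I\<close> alone, not on \<open>X\<close> or
    \<open>c\<close>, so finitely many null sets will suffice.\<close>
  have "\<exists>N. negligible N \<and> (\<forall>X c. (\<forall>i j. X $ i $ j = (\<Sum>l\<in>I. c i l * X $ l $ j))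
      \<longrightarrow> entries_at \<omega> X \<in> N)" if I: "card I = r" for I
  proof -
    have less: "card (param_positions I) < CARD('m)"
      using m I by (simp add: card_param_positions)
    then obtain p :: "'n \<times> 'n \<Rightarrow> 'm" where p: "inj_on p (param_positions I)"
      using card_le_inj[of "param_positions I" "UNIV :: 'm set"] by auto
    have "card (p ` param_positions I) < CARD('m)"
      using less p by (simp add: card_image)
    then have "p ` param_positions I \<noteq> UNIV"
      by auto
    then obtain k where k: "k \<notin> p ` param_positions I"
      by blast
    define H where "H = {y :: complex ^ 'm. y $ k = 0}"
    \<comment> \<open>The inner product is real: it is the real part of \<open>y $ k\<close>, so the
      complex hyperplane lies in a real one.\<close>
    have "H \<subseteq> {y. axis k 1 \<bullet> y = 0}"
      by (auto simp: H_def inner_axis')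
    moreover have "negligible {y :: complex ^ 'm. axis k 1 \<bullet> y = 0}"
      by (intro negligible_hyperplane) (simp add: axis_eq_0_iff)
    ultimately have "negligible H"
      by (rule negligible_subset[rotated])
    \<comment> \<open>Source and target are both \<open>complex ^ 'm\<close>; because the dimensions
      agree, a differentiable map preserves null sets.\<close>
    then have "negligible ((\<lambda>y. entries_at \<omega> (fill_rows I p y)) ` H)"
      by (intro negligible_differentiable_image_negligible differentiable_entries_at_fill_rows) auto
    moreover have "entries_at \<omega> X \<in> (\<lambda>y. entries_at \<omega> (fill_rows I p y)) ` H"
      if "\<And>i j. X $ i $ j = (\<Sum>l\<in>I. c i l * X $ l $ j)" for X c
      using fill_rows_surj[OF p k that] by (metis (mono_tags) H_def image_eqI mem_Collect_eq)
    ultimately show ?thesis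
      by blast
  qed
  then obtain N where N: "\<And>I. card I = r \<Longrightarrow> negligible (N I)"
      "\<And>I X c. card I = r \<Longrightarrow> (\<And>i j. X $ i $ j = (\<Sum>l\<in>I. c i l * X $ l $ j))
        \<Longrightarrow> entries_at \<omega> X \<in> N I"
    by metis
  \<comment> \<open>A finite index type has only finitely many subsets \<open>I\<close>.\<close>
  have "negligible (\<Union>I\<in>{I. card I = r}. N I)"
    by (intro negligible_Union) (auto simp: N(1))
  moreover have "?R \<subseteq> (\<Union>I\<in>{I. card I = r}. N I)"
  proof
    fix x assume "x \<in> ?R"
    then obtain X :: "complex ^ 'n ^ 'n" where X: "rank X = r" "x = entries_at \<omega> X"
      by auto
    obtain I c where "card I = rank X" "\<And>i j. X $ i $ j = (\<Sum>l\<in>I. c i l * X $ l $ j)"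
      using rank_basis_rows[of X] by metis
    then show "x \<in> (\<Union>I\<in>{I. card I = r}. N I)"
      using X N(2) by blast
  qed
  ultimately show ?thesis
    using negligible_subset negligible_iff_null_sets by blast
qed

end
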